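(* Let $Z=(Z^+,Z^-)$ be the Filippov vector field given by $Z^+=(X^+,Y^+)$ for $y>0$ and $Z^-=(X^-,Y^-)$ for $y<0$, where $Z^{+}$ and $Z^{-}$ are analytic on a neighborhood of the origin of $\mathbb{R}^2$. Assume that $Z$ has a $(2k^+,2k^-)$-monodromic tangential singularity at the origin, for positive integers $k^+$ and $k^-$, and let $V_n$, $n\ge2$, denote its Lyapunov coefficients. Let $\ell\geq 1$ be an integer. If $V_n=0$ for every $n=2,\ldots,2\ell$, then $V_{2\ell+1}=0$.
   Context: The origin is a $(2k^+,2k^-)$-monodromic tangential singularity of $Z$ (discontinuity line $\Sigma=\{y=0\}$) when it is an invisible contact of multiplicity $2k^{+}$ of $Z^+$ with $\Sigma$, an invisible contact of multiplicity $2k^-$ of $Z^-$ with $\Sigma$, and a first-return map on $\Sigma$ is defined around it; concretely: C1. $X^{\pm}(0,0)\neq0$, $Y^{\pm}(0,0)=0$, $\frac{\partial^i Y^{\pm}}{\partial x^i}(0,0)=0$ for $i=1,\ldots,2k^{\pm}-2$, and $\frac{\partial^{2k^{\pm}-1} Y^{\pm}}{\partial x^{2k^{\pm}-1}}(0,0)\neq0$; C2. $X^+(0,0)\frac{\partial^{2k^{+}-1} Y^{+}}{\partial x^{2k^{+}-1}}(0,0)<0$ and $X^-(0,0)\frac{\partial^{2k^{-}-1} Y^{-}}{\partial x^{2k^{-}-1}}(0,0)>0$; C3. $X^+(0,0)X^-(0,0)<0$. Put $\delta=\mathrm{sign}(X^+(0,0))=-\mathrm{sign}(X^-(0,0))$.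 Half-return maps: for $x\neq 0$ close to $0$, the orbit of $Z^{+}$ through $(x,0)$ restricted to $\{y\ge 0\}$ (resp. of $Z^-$ restricted to $\{y\le0\}$), followed forward or backward in time (whichever direction enters $\{y>0\}$, resp. $\{y<0\}$), meets $\Sigma$ again for the first time at $(\varphi^{+}(x),0)$ (resp. $(\varphi^{-}(x),0)$); $\varphi^{\pm}(0)=0$. The maps $\varphi^{\pm}$ are analytic involutions near $0$, with expansions $\varphi^{\pm}(x)=-x+\sum_{n\ge2}\alpha_n^{\pm}x^n$. The displacement function is $\Delta(x)=\delta(\varphi^+(x)-\varphi^-(x))=\sum_{n\ge2}V_nx^n$; the $n$th Lyapunov coefficient is $V_n=\delta(\alpha_n^+-\alpha_n^-)$. *)

theory Defs
  imports "HOL-Analysis.Analysis"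
begin

type_synonym vfield = "real \<times> real \<Rightarrow> real \<times> real"

text \<open>Real analyticity in two variables: near every point of the set, the function is the sum of
  an (unconditionally convergent) double power series centred at that point.\<close>

definition real_analytic2_on :: "(real \<times> real \<Rightarrow> real) \<Rightarrow> (real \<times> real) set \<Rightarrow> bool" where
  "real_analytic2_on f U \<longleftrightarrow>
     (\<forall>(a, b) \<in> U. \<exists>c :: nat \<Rightarrow> nat \<Rightarrow> real. \<exists>r > 0. \<forall>x y. \<bar>x\<bar> < r \<longrightarrow> \<bar>y\<bar> < r \<longrightarrow>
        ((\<lambda>(i, j). c i j * x ^ i * y ^ j) has_sum f (a + x, b + y)) UNIV)"

definition analytic_vfield_on :: "vfield \<Rightarrow> (real \<times> real) set \<Rightarrow> bool" where
  "analytic_vfield_on F U \<longleftrightarrow>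
     real_analytic2_on (\<lambda>p. fst (F p)) U \<and> real_analytic2_on (\<lambda>p. snd (F p)) U"

definition partial_x :: "nat \<Rightarrow> (real \<times> real \<Rightarrow> real) \<Rightarrow> real \<times> real \<Rightarrow> real" where
  "partial_x i f p = (deriv ^^ i) (\<lambda>s. f (s, snd p)) (fst p)"

definition contact_of_multiplicity :: "nat \<Rightarrow> vfield \<Rightarrow> bool" where
  "contact_of_multiplicity m F \<longleftrightarrow>
     fst (F (0, 0)) \<noteq> 0 \<and> snd (F (0, 0)) = 0 \<and>
     (\<forall>i \<in> {1..m - 2}. partial_x i (\<lambda>p. snd (F p)) (0, 0) = 0) \<and>
     partial_x (m - 1) (\<lambda>p. snd (F p)) (0, 0) \<noteq> 0"

definition monodromic_tangential_singularity :: "nat \<Rightarrow> nat \<Rightarrow> vfield \<Rightarrow> vfield \<Rightarrow> bool" where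
  "monodromic_tangential_singularity kp km Zp Zm \<longleftrightarrow>
     contact_of_multiplicity (2 * kp) Zp \<and> contact_of_multiplicity (2 * km) Zm \<and>
     fst (Zp (0, 0)) * partial_x (2 * kp - 1) (\<lambda>p. snd (Zp p)) (0, 0) < 0 \<and>
     fst (Zm (0, 0)) * partial_x (2 * km - 1) (\<lambda>p. snd (Zm p)) (0, 0) > 0 \<and>
     fst (Zp (0, 0)) * fst (Zm (0, 0)) < 0"

text \<open>The orbit of \<open>F\<close> in \<open>U\<close> through \<open>(x, 0)\<close> reaches \<open>(x', 0)\<close> at time \<open>\<tau>\<close>, staying strictly in
  the open half-plane \<open>s * y > 0\<close> in between, so that this is its first return to \<open>y = 0\<close>.
  A negative \<open>\<tau>\<close> means that the orbit is followed backward in time. The sign \<open>s\<close> is \<open>1\<close> for the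
  upper and \<open>-1\<close> for the lower half-plane.\<close>

definition half_return :: "real \<Rightarrow> (real \<times> real) set \<Rightarrow> vfield \<Rightarrow> real \<Rightarrow> real \<Rightarrow> bool" where
  "half_return s U F x x' \<longleftrightarrow>
     (\<exists>\<tau> \<gamma>. \<tau> \<noteq> 0 \<and> \<gamma> 0 = (x, 0) \<and> \<gamma> \<tau> = (x', 0) \<and>
        (\<forall>t \<in> closed_segment 0 \<tau>. \<gamma> t \<in> U \<and>
           (\<gamma> has_vector_derivative F (\<gamma> t)) (at t within closed_segment 0 \<tau>)) \<and>
        (\<forall>t \<in> open_segment 0 \<tau>. s * snd (\<gamma> t) > 0))"

definition half_return_map :: "real \<Rightarrow> (real \<times> real) set \<Rightarrow> vfield \<Rightarrow> (real \<Rightarrow> real) \<Rightarrow> bool" where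
  "half_return_map s U F \<phi> \<longleftrightarrow>
     \<phi> 0 = 0 \<and> (\<exists>\<epsilon> > 0. \<forall>x. x \<noteq> 0 \<longrightarrow> \<bar>x\<bar> < \<epsilon> \<longrightarrow> half_return s U F x (\<phi> x))"

definition expansion_at_0 :: "(real \<Rightarrow> real) \<Rightarrow> (nat \<Rightarrow> real) \<Rightarrow> bool" where
  "expansion_at_0 \<phi> \<alpha> \<longleftrightarrow> (\<exists>r > 0. \<forall>x. \<bar>x\<bar> < r \<longrightarrow> (\<lambda>n. \<alpha> n * x ^ n) sums \<phi> x)"

text \<open>\<open>V\<close> is the sequence of Lyapunov coefficients (for indices at least 2) of the Filippov vector
  field given by \<open>Zp\<close> on \<open>y > 0\<close> and \<open>Zm\<close> on \<open>y < 0\<close>. At a monodromic tangential singularity the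
  germs at \<open>0\<close> of the half-return maps, and hence their expansions and \<open>V n\<close> for \<open>n \<ge> 2\<close>, are
  uniquely determined. That the half-return maps are involutions with linear part \<open>-x\<close> is not
  part of the definition.\<close>

definition lyapunov_coefficients ::
    "(real \<times> real) set \<Rightarrow> vfield \<Rightarrow> vfield \<Rightarrow> (nat \<Rightarrow> real) \<Rightarrow> bool" where
  "lyapunov_coefficients U Zp Zm V \<longleftrightarrow>
     (\<exists>\<phi>p \<phi>m \<alpha>p \<alpha>m.
        half_return_map 1 U Zp \<phi>p \<and> half_return_map (-1) U Zm \<phi>m \<and>
        expansion_at_0 \<phi>p \<alpha>p \<and> expansion_at_0 \<phi>m \<alpha>m \<and>
        (\<forall>n \<ge> 2. V n = sgn (fst (Zp (0, 0))) * (\<alpha>p n - \<alpha>m n)))"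

end

theory Submission
  imports Defs
begin

text \<open>A half-return orbit traversed backwards is again a half-return orbit. On the axis near the origin
  the vertical component \<open>Y(x, 0)\<close> vanishes only at \<open>0\<close>, so the time direction entering the
  half-plane is determined, orbits are unique, and both half-return maps are involutions. Hence their
  linear coefficients are \<open>\<plusminus>1\<close>; the value \<open>1\<close> is excluded because \<open>Y(x, 0)\<close> and \<open>Y(\<phi>(x), 0)\<close>
  have opposite signs whereas \<open>Y(\<cdot>, 0)\<close> has constant sign on each side of \<open>0\<close>. Two involutions
  \<open>-x + \<dots>\<close> cannot first differ in an odd coefficient.\<close>

section \<open>Analytic vector fields are locally Lipschitz\<close>

text \<open>The mean value bound i \<rho>^(i-1) |x - y| with i \<le> 2^i. Multiplying by \<rho>
  avoids both the exponent i - 1 and a division, and \<rho> = 0 needs no separate treatment.\<close>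

lemma abs_power_diff_le:
  fixes x y \<rho> :: real
  assumes "\<bar>x\<bar> \<le> \<rho>" "\<bar>y\<bar> \<le> \<rho>"
  shows "\<rho> * \<bar>x ^ i - y ^ i\<bar> \<le> (2 * \<rho>) ^ i * \<bar>x - y\<bar>"
proof (induction i)
  case 0
  then show ?case by simp
next
  case (Suc i)
  have \<rho>: "0 \<le> \<rho>" using assms by linarith
  have "\<rho> * \<bar>x ^ Suc i - y ^ Suc i\<bar> = \<rho> * \<bar>x * (x ^ i - y ^ i) + (x - y) * y ^ i\<bar>"
    by (simp add: algebra_simps)
  also have "\<dots> \<le> \<rho> * (\<bar>x\<bar> * \<bar>x ^ i - y ^ i\<bar> + \<bar>x - y\<bar> * \<bar>y\<bar> ^ i)"
    using \<rho> by (intro mult_left_mono order_trans[OF abs_triangle_ineq]) (auto simp: abs_mult power_abs)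
  also have "\<dots> = \<bar>x\<bar> * (\<rho> * \<bar>x ^ i - y ^ i\<bar>) + \<rho> * \<bar>y\<bar> ^ i * \<bar>x - y\<bar>"
    by (simp add: algebra_simps)
  also have "\<dots> \<le> \<rho> * ((2 * \<rho>) ^ i * \<bar>x - y\<bar>) + \<rho> * (2 * \<rho>) ^ i * \<bar>x - y\<bar>"
    using assms \<rho> by (intro add_mono mult_mono[OF _ Suc.IH] mult_right_mono mult_left_mono power_mono) auto
  also have "\<dots> = (2 * \<rho>) ^ Suc i * \<bar>x - y\<bar>" by simp
  finally show ?case .
qed

text \<open>One variable is changed at a time. The factor on the right is the same monomial
  evaluated at (2\<rho>, 2\<rho>), so it serves as a majorant for a power series converging
  there.\<close>

lemma abs_monomial_diff_le:
  fixes x y x' y' \<rho> :: real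
  assumes "\<bar>x\<bar> \<le> \<rho>" "\<bar>y\<bar> \<le> \<rho>" "\<bar>x'\<bar> \<le> \<rho>" "\<bar>y'\<bar> \<le> \<rho>"
  shows "\<rho> * \<bar>x ^ i * y ^ j - x' ^ i * y' ^ j\<bar> \<le> (2 * \<rho>) ^ i * (2 * \<rho>) ^ j * (\<bar>x - x'\<bar> + \<bar>y - y'\<bar>)"
proof -
  have \<rho>: "0 \<le> \<rho>" using assms by linarith
  have "\<rho> * \<bar>x ^ i * y ^ j - x' ^ i * y' ^ j\<bar>
      = \<rho> * \<bar>(x ^ i - x' ^ i) * y ^ j + x' ^ i * (y ^ j - y' ^ j)\<bar>"
    by (simp add: algebra_simps)
  also have "\<dots> \<le> \<rho> * (\<bar>x ^ i - x' ^ i\<bar> * \<bar>y\<bar> ^ j + \<bar>x'\<bar> ^ i * \<bar>y ^ j - y' ^ j\<bar>)"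
    using \<rho> by (intro mult_left_mono order_trans[OF abs_triangle_ineq]) (auto simp: abs_mult power_abs)
  also have "\<dots> = (\<rho> * \<bar>x ^ i - x' ^ i\<bar>) * \<bar>y\<bar> ^ j + \<bar>x'\<bar> ^ i * (\<rho> * \<bar>y ^ j - y' ^ j\<bar>)"
    by (simp add: algebra_simps)
  also have "\<dots> \<le> ((2 * \<rho>) ^ i * \<bar>x - x'\<bar>) * (2 * \<rho>) ^ j + (2 * \<rho>) ^ i * ((2 * \<rho>) ^ j * \<bar>y - y'\<bar>)"
    using assms \<rho> by (intro add_mono mult_mono abs_power_diff_le power_mono) auto
  finally show ?thesis by (simp add: algebra_simps)
qed

text \<open>The monomials are Lipschitz with constants that, weighted by |c i j|, are dominated by
  the absolute series at (2\<rho>, 2\<rho>); summing these estimates gives a constant proportional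
  to the sum \<open>M\<close> of that series.\<close>

lemma real_analytic2_on_locally_lipschitz:
  assumes "real_analytic2_on f U" "p \<in> U"
  shows "\<exists>d>0. \<exists>L. L-lipschitz_on (ball p d) f"
proof -
  obtain a b where p: "p = (a, b)" by force
  with assms obtain c r where "r > 0" and
    sums: "\<And>x y. \<bar>x\<bar> < r \<Longrightarrow> \<bar>y\<bar> < r \<Longrightarrow>
        ((\<lambda>(i, j). c i j * x ^ i * y ^ j) has_sum f (a + x, b + y)) UNIV"
    unfolding real_analytic2_on_def by fast
  \<comment> \<open>This keeps (2\<rho>, 2\<rho>), the point of the majorant, inside the square of
    convergence.\<close>
  define \<rho> where "\<rho> = r / 4"
  have \<rho>: "\<rho> > 0" "2 * \<rho> < r" using \<open>r > 0\<close> by (auto simp: \<rho>_def)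
  let ?m = "\<lambda>(i, j). \<bar>c i j\<bar> * ((2 * \<rho>) ^ i * (2 * \<rho>) ^ j)"
  have "(\<lambda>(i, j). c i j * (2 * \<rho>) ^ i * (2 * \<rho>) ^ j) summable_on UNIV"
    using sums[of "2 * \<rho>" "2 * \<rho>"] \<rho> by (auto intro: has_sum_imp_summable)
  \<comment> \<open>For real families unconditional and absolute summability coincide.\<close>
  then have "(\<lambda>ij. norm ((\<lambda>(i, j). c i j * (2 * \<rho>) ^ i * (2 * \<rho>) ^ j) ij)) summable_on UNIV"
    using summable_on_iff_abs_summable_on_real by blast
  also have "(\<lambda>ij. norm ((\<lambda>(i, j). c i j * (2 * \<rho>) ^ i * (2 * \<rho>) ^ j) ij)) = ?m"
    using \<rho> by (auto simp: abs_mult mult.assoc)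
  finally obtain M where M: "(?m has_sum M) UNIV" by (auto simp: summable_on_def)
  have "0 \<le> M"
    using M by (rule has_sum_nonneg) (use \<rho> in auto)
  have bound: "\<bar>f q - f q'\<bar> \<le> 2 * M / \<rho> * dist q q'" if "q \<in> ball p \<rho>" "q' \<in> ball p \<rho>" for q q'
  proof -
    define x y x' y' where xy: "x = fst q - a" "y = snd q - b" "x' = fst q' - a" "y' = snd q' - b"
    have small: "\<bar>x\<bar> \<le> \<rho>" "\<bar>y\<bar> \<le> \<rho>" "\<bar>x'\<bar> \<le> \<rho>" "\<bar>y'\<bar> \<le> \<rho>"
      using that dist_fst_le[of p q] dist_snd_le[of p q] dist_fst_le[of p q'] dist_snd_le[of p q']
      by (auto simp: xy p dist_real_def)
    have fq: "f q = f (a + x, b + y)" "f q' = f (a + x', b + y')" by (simp_all add: xy)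
    let ?D = "\<bar>x - x'\<bar> + \<bar>y - y'\<bar>"
    let ?t = "\<lambda>x y (i, j). c i j * x ^ i * y ^ j"
    have S: "((\<lambda>ij. \<rho> * (?t x y ij - ?t x' y' ij)) has_sum \<rho> * (f q - f q')) UNIV"
    proof -
      have "(?t x y has_sum f q) UNIV" "((\<lambda>ij. - ?t x' y' ij) has_sum - f q') UNIV"
        unfolding fq using sums[of x y] sums[of x' y'] small \<rho> by (simp_all add: has_sum_uminus)
      from has_sum_add[OF this] show ?thesis by (intro has_sum_cmult_right) simp
    qed
    have T: "((\<lambda>ij. ?m ij * ?D) has_sum M * ?D) UNIV"
      by (intro has_sum_cmult_left M)
    have "norm (\<rho> * (f q - f q')) \<le> M * ?D"
    proof (rule norm_infsum_le[OF S T])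
      fix ij :: "nat \<times> nat"
      obtain i j where ij: "ij = (i, j)" by force
      have "norm (\<rho> * (?t x y ij - ?t x' y' ij)) = \<bar>c i j\<bar> * (\<rho> * \<bar>x ^ i * y ^ j - x' ^ i * y' ^ j\<bar>)"
        using \<rho> by (simp add: ij abs_mult right_diff_distrib[symmetric] mult.assoc)
      also have "\<dots> \<le> \<bar>c i j\<bar> * ((2 * \<rho>) ^ i * (2 * \<rho>) ^ j * ?D)"
        by (intro mult_left_mono abs_monomial_diff_le small) simp
      finally show "norm (\<rho> * (?t x y ij - ?t x' y' ij)) \<le> ?m ij * ?D"
        by (simp add: ij mult.assoc)
    qed
    \<comment> \<open>Each coordinate difference is at most the Euclidean distance, hence the factor
      2.\<close>
    also have "M * ?D \<le> M * (2 * dist q q')"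
      using dist_fst_le[of q q'] dist_snd_le[of q q'] \<open>0 \<le> M\<close>
      by (intro mult_left_mono) (auto simp: xy dist_real_def)
    finally have "\<rho> * \<bar>f q - f q'\<bar> \<le> M * (2 * dist q q')" using \<rho> by (simp add: abs_mult)
    then show ?thesis using \<rho> by (simp add: field_simps)
  qed
  have "(2 * M / \<rho>)-lipschitz_on (ball p \<rho>) f"
    using bound \<open>0 \<le> M\<close> \<rho> by (intro lipschitz_onI) (auto simp: dist_real_def)
  with \<rho> show ?thesis by blast
qed

lemma analytic_vfield_on_locally_lipschitz:
  assumes "analytic_vfield_on F U" "p \<in> U"
  shows "\<exists>d>0. \<exists>L. L-lipschitz_on (ball p d) F"
proof -
  have an: "real_analytic2_on (\<lambda>p. fst (F p)) U" "real_analytic2_on (\<lambda>p. snd (F p)) U"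
    using assms(1) by (auto simp: analytic_vfield_on_def)
  obtain d L where 1: "d > 0" "L-lipschitz_on (ball p d) (\<lambda>p. fst (F p))"
    using real_analytic2_on_locally_lipschitz[OF an(1) assms(2)] by blast
  obtain e M where 2: "e > 0" "M-lipschitz_on (ball p e) (\<lambda>p. snd (F p))"
    using real_analytic2_on_locally_lipschitz[OF an(2) assms(2)] by blast
  have "(sqrt (L\<^sup>2 + M\<^sup>2))-lipschitz_on (ball p (min d e)) (\<lambda>p. (fst (F p), snd (F p)))"
    using 1 2 by (intro lipschitz_on_Pair) (auto intro: lipschitz_on_subset)
  with 1 2 show ?thesis by (intro exI[of _ "min d e"]) auto
qed

section \<open>Uniqueness of orbits\<close>

text \<open>On a short enough interval the maximal distance between the two solutions is at most
  half of itself, by the mean value inequality, so it vanishes. Derivatives are taken within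
  \<open>S\<close>, which also covers its end points.\<close>

lemma ode_locally_unique:
  fixes F :: "'a::real_normed_vector \<Rightarrow> 'a"
  assumes S: "convex S" "compact S" "t\<^sub>0 \<in> S"
    and \<gamma>: "\<And>t. t \<in> S \<Longrightarrow> (\<gamma> has_vector_derivative F (\<gamma> t)) (at t within S)"
    and \<eta>: "\<And>t. t \<in> S \<Longrightarrow> (\<eta> has_vector_derivative F (\<eta> t)) (at t within S)"
    and eq: "\<gamma> t\<^sub>0 = \<eta> t\<^sub>0"
    and lip: "d > 0" "L-lipschitz_on (ball (\<gamma> t\<^sub>0) d) F"
  shows "\<exists>e>0. \<forall>t\<in>S. \<bar>t - t\<^sub>0\<bar> < e \<longrightarrow> \<gamma> t = \<eta> t"
proof -
  have cont: "continuous_on S \<gamma>" "continuous_on S \<eta>"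
    using \<gamma> \<eta> has_vector_derivative_continuous continuous_on_eq_continuous_within by blast+
  have "L \<ge> 0" using lip(2) by (rule lipschitz_on_nonneg)
  obtain e1 where e1: "e1 > 0" "\<And>t. t \<in> S \<Longrightarrow> dist t t\<^sub>0 < e1 \<Longrightarrow> dist (\<gamma> t) (\<gamma> t\<^sub>0) < d"
    using cont(1) S(3) lip(1) unfolding continuous_on_iff by blast
  obtain e2 where e2: "e2 > 0" "\<And>t. t \<in> S \<Longrightarrow> dist t t\<^sub>0 < e2 \<Longrightarrow> dist (\<eta> t) (\<eta> t\<^sub>0) < d"
    using cont(2) S(3) lip(1) unfolding continuous_on_iff by blast
  \<comment> \<open>The first bound keeps both solutions in the ball where \<open>F\<close> is
    Lipschitz; the second gives e L \<le> 1/2, with L + 1 in place of L to avoid division by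
    zero.\<close>
  define e where "e = min (min e1 e2 / 2) (1 / (2 * (L + 1)))"
  have e: "e > 0" "e < e1" "e < e2" "e * L \<le> 1 / 2"
  proof -
    show "e > 0" "e < e1" "e < e2"
      using e1(1) e2(1) \<open>L \<ge> 0\<close> unfolding e_def by auto
    have "e * L \<le> 1 / (2 * (L + 1)) * L"
      using \<open>L \<ge> 0\<close> by (intro mult_right_mono) (auto simp: e_def)
    also have "\<dots> \<le> 1 / 2" using \<open>L \<ge> 0\<close> by (simp add: field_simps)
    finally show "e * L \<le> 1 / 2" .
  qed
  define J where "J = S \<inter> cball t\<^sub>0 e"
  define w where "w t = \<gamma> t - \<eta> t" for t
  have J: "convex J" "compact J" "t\<^sub>0 \<in> J" "J \<subseteq> S"
    using S e by (auto simp: J_def intro: convex_Int compact_Int_closed)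
  have "continuous_on J (\<lambda>t. norm (w t))"
    unfolding w_def using cont J(4) by (intro continuous_intros) (auto intro: continuous_on_subset)
  then obtain t1 where t1: "t1 \<in> J" "\<And>t. t \<in> J \<Longrightarrow> norm (w t) \<le> norm (w t1)"
    using continuous_attains_sup[of J "\<lambda>t. norm (w t)"] J by blast
  have der: "norm (F (\<gamma> t) - F (\<eta> t)) \<le> L * norm (w t1)" if "t \<in> J" for t
  proof -
    have "dist t t\<^sub>0 < e1" "dist t t\<^sub>0 < e2" "t \<in> S"
      using that e by (auto simp: J_def dist_commute)
    then have "dist (\<gamma> t) (\<gamma> t\<^sub>0) < d" "dist (\<eta> t) (\<gamma> t\<^sub>0) < d"
      using e1(2) e2(2) eq by simp_all
    then have "dist (F (\<gamma> t)) (F (\<eta> t)) \<le> L * dist (\<gamma> t) (\<eta> t)"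
      by (intro lipschitz_onD[OF lip(2)]) (auto simp: dist_commute)
    also have "\<dots> \<le> L * norm (w t1)"
      using t1(2)[OF that] \<open>L \<ge> 0\<close> by (intro mult_left_mono) (auto simp: w_def dist_norm)
    finally show ?thesis by (simp add: dist_norm)
  qed
  \<comment> \<open>Here \<open>t1\<close> maximises the distance on \<open>J\<close>, so the speed
    of \<open>w\<close> is bounded throughout \<open>J\<close> by L times its value at
    \<open>t1\<close>.\<close>
  have "norm (w t1 - w t\<^sub>0) \<le> (L * norm (w t1)) * norm (t1 - t\<^sub>0)"
  proof (rule differentiable_bound[OF J(1) _ _ t1(1) J(3)])
    fix t assume t: "t \<in> J"
    show "(w has_derivative (\<lambda>h. h *\<^sub>R (F (\<gamma> t) - F (\<eta> t)))) (at t within J)"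
      using has_vector_derivative_diff[OF \<gamma> \<eta>, of t] t J(4)
      unfolding w_def has_vector_derivative_def by (auto intro: has_derivative_subset)
    show "onorm (\<lambda>h. h *\<^sub>R (F (\<gamma> t) - F (\<eta> t))) \<le> L * norm (w t1)"
      using der[OF t] by (intro onorm_le) (simp add: mult.commute mult_left_mono)
  qed
  also have "w t1 - w t\<^sub>0 = w t1" by (simp add: w_def eq)
  also have "(L * norm (w t1)) * norm (t1 - t\<^sub>0) \<le> (L * norm (w t1)) * e"
    using t1(1) \<open>L \<ge> 0\<close> by (intro mult_left_mono) (auto simp: J_def dist_real_def abs_minus_commute)
  also have "\<dots> = (e * L) * norm (w t1)" by simp
  also have "\<dots> \<le> 1 / 2 * norm (w t1)"
    using e(4) by (intro mult_right_mono) auto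
  finally have "norm (w t1) \<le> 0" by simp
  then have "w t = 0" if "t \<in> J" for t using t1(2)[OF that] by simp
  then show ?thesis
    using e(1) by (intro exI[of _ e]) (auto simp: J_def w_def dist_real_def abs_minus_commute)
qed

text \<open>The set where the solutions agree is closed by continuity and open by local uniqueness,
  and \<open>S\<close> is connected.\<close>

lemma ode_unique:
  fixes F :: "'a::real_normed_vector \<Rightarrow> 'a"
  assumes S: "convex S" "compact S" "t\<^sub>0 \<in> S"
    and \<gamma>: "\<And>t. t \<in> S \<Longrightarrow> (\<gamma> has_vector_derivative F (\<gamma> t)) (at t within S)"
    and \<eta>: "\<And>t. t \<in> S \<Longrightarrow> (\<eta> has_vector_derivative F (\<eta> t)) (at t within S)"
    and eq: "\<gamma> t\<^sub>0 = \<eta> t\<^sub>0"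
    and lip: "\<And>t. t \<in> S \<Longrightarrow> \<exists>d>0. \<exists>L. L-lipschitz_on (ball (\<gamma> t) d) F"
    and "t \<in> S"
  shows "\<gamma> t = \<eta> t"
proof -
  have cont: "continuous_on S \<gamma>" "continuous_on S \<eta>"
    using \<gamma> \<eta> has_vector_derivative_continuous continuous_on_eq_continuous_within by blast+
  define A where "A = {t \<in> S. \<gamma> t - \<eta> t = 0}"
  have "closedin (top_of_set S) A"
    unfolding A_def by (intro continuous_closedin_preimage_constant continuous_intros cont)
  moreover have "openin (top_of_set S) A"
    unfolding openin_euclidean_subtopology_iff
  proof (intro conjI ballI)
    show "A \<subseteq> S" by (auto simp: A_def)
    fix s assume s: "s \<in> A"
    then have "s \<in> S" "\<gamma> s = \<eta> s" by (auto simp: A_def)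
    then obtain e where "e > 0" "\<forall>t\<in>S. \<bar>t - s\<bar> < e \<longrightarrow> \<gamma> t = \<eta> t"
      using ode_locally_unique[OF S(1,2) _ \<gamma> \<eta>] lip by metis
    then show "\<exists>e>0. \<forall>x'\<in>S. dist x' s < e \<longrightarrow> x' \<in> A"
      by (auto simp: A_def dist_real_def)
  qed
  ultimately have "A = {} \<or> A = S"
    using convex_connected[OF S(1)] connected_clopen by blast
  with S(3) eq \<open>t \<in> S\<close> show ?thesis by (auto simp: A_def)
qed

section \<open>Half-return orbits\<close>

text \<open>The signed travel time, hidden in \<open>half_return\<close>, becomes a parameter: its
  sign tells forward from backward orbits.\<close>

definition half_orbit ::
    "real \<Rightarrow> (real \<times> real) set \<Rightarrow> vfield \<Rightarrow> real \<Rightarrow> real \<Rightarrow> real \<Rightarrow> bool" where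
  "half_orbit s U F \<tau> x x' \<longleftrightarrow> \<tau> \<noteq> 0 \<and>
     (\<exists>\<gamma>. \<gamma> 0 = (x, 0) \<and> \<gamma> \<tau> = (x', 0) \<and>
        (\<forall>t \<in> closed_segment 0 \<tau>. \<gamma> t \<in> U \<and>
           (\<gamma> has_vector_derivative F (\<gamma> t)) (at t within closed_segment 0 \<tau>)) \<and>
        (\<forall>t \<in> open_segment 0 \<tau>. s * snd (\<gamma> t) > 0))"

lemma half_return_iff: "half_return s U F x x' \<longleftrightarrow> (\<exists>\<tau>. half_orbit s U F \<tau> x x')"
  unfolding half_return_def half_orbit_def by blast

text \<open>The field is autonomous, so t \<mapsto> \<gamma>(t + \<tau>) is again an orbit; it
  starts at the old end point and reaches the old start at time -\<tau>.\<close>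

lemma half_orbit_reverse:
  assumes "half_orbit s U F \<tau> x x'"
  shows "half_orbit s U F (- \<tau>) x' x"
proof -
  obtain \<gamma> where \<tau>: "\<tau> \<noteq> 0" and \<gamma>: "\<gamma> 0 = (x, 0)" "\<gamma> \<tau> = (x', 0)"
      "\<And>t. t \<in> closed_segment 0 \<tau> \<Longrightarrow> \<gamma> t \<in> U"
      "\<And>t. t \<in> closed_segment 0 \<tau> \<Longrightarrow>
         (\<gamma> has_vector_derivative F (\<gamma> t)) (at t within closed_segment 0 \<tau>)"
      "\<And>t. t \<in> open_segment 0 \<tau> \<Longrightarrow> s * snd (\<gamma> t) > 0"
    using assms unfolding half_orbit_def by blast
  have shift: "(\<lambda>t. t + \<tau>) ` closed_segment 0 (- \<tau>) = closed_segment 0 \<tau>"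
    using closed_segment_translation[of \<tau> 0 "- \<tau>"]
    by (simp add: add.commute closed_segment_commute)
  have mem: "t + \<tau> \<in> closed_segment 0 \<tau>" if "t \<in> closed_segment 0 (- \<tau>)" for t
    using shift that by blast
  have mem': "t + \<tau> \<in> open_segment 0 \<tau>" if "t \<in> open_segment 0 (- \<tau>)" for t
    using that mem[of t] by (auto simp: open_segment_def)
  have "((\<lambda>t. \<gamma> (t + \<tau>)) has_vector_derivative F (\<gamma> (t + \<tau>))) (at t within closed_segment 0 (- \<tau>))"
    if "t \<in> closed_segment 0 (- \<tau>)" for t
  proof -
    have "((\<lambda>t. t + \<tau>) has_vector_derivative 1) (at t within closed_segment 0 (- \<tau>))"
      by (auto intro!: derivative_eq_intros)
    from vector_diff_chain_within[OF this, of \<gamma> "F (\<gamma> (t + \<tau>))"] \<gamma>(4)[OF mem[OF that]]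
    show ?thesis by (simp add: shift o_def)
  qed
  then show ?thesis
    using \<tau> \<gamma> mem mem' unfolding half_orbit_def
    by (intro conjI exI[of _ "\<lambda>t. \<gamma> (t + \<tau>)"]) auto
qed

text \<open>Both orbits agree for as long as the shorter one lasts. At that time it is on the axis,
  whereas the other would still be strictly off it unless it ended at the same moment.\<close>

lemma half_orbit_unique:
  assumes an: "analytic_vfield_on F U"
    and orb: "half_orbit s U F \<tau> x x'" "half_orbit s U F \<tau>' x x''" and "\<tau> * \<tau>' > 0"
  shows "x' = x''"
proof -
  have le: "x' = x''"
    if orb: "half_orbit s U F \<tau> x x'" "half_orbit s U F \<tau>' x x''"
      and sign: "\<tau> * \<tau>' > 0" and le: "\<bar>\<tau>\<bar> \<le> \<bar>\<tau>'\<bar>" for \<tau> \<tau>' x' x''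
  proof -
    obtain \<gamma> where \<tau>: "\<tau> \<noteq> 0" and \<gamma>: "\<gamma> 0 = (x, 0)" "\<gamma> \<tau> = (x', 0)"
        "\<And>t. t \<in> closed_segment 0 \<tau> \<Longrightarrow> \<gamma> t \<in> U"
        "\<And>t. t \<in> closed_segment 0 \<tau> \<Longrightarrow>
           (\<gamma> has_vector_derivative F (\<gamma> t)) (at t within closed_segment 0 \<tau>)"
      using orb(1) unfolding half_orbit_def by blast
    obtain \<eta> where \<eta>: "\<eta> 0 = (x, 0)" "\<eta> \<tau>' = (x'', 0)"
        "\<And>t. t \<in> closed_segment 0 \<tau>' \<Longrightarrow>
           (\<eta> has_vector_derivative F (\<eta> t)) (at t within closed_segment 0 \<tau>')"
        "\<And>t. t \<in> open_segment 0 \<tau>' \<Longrightarrow> s * snd (\<eta> t) > 0"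
      using orb(2) unfolding half_orbit_def by blast
    have mem: "\<tau> \<in> closed_segment 0 \<tau>'"
      using sign le by (auto simp: closed_segment_eq_real_ivl zero_less_mult_iff)
    then have sub: "closed_segment 0 \<tau> \<subseteq> closed_segment 0 \<tau>'"
      by (simp add: subset_closed_segment)
    have "\<gamma> \<tau> = \<eta> \<tau>"
    proof (rule ode_unique[of "closed_segment 0 \<tau>" 0 \<gamma> F \<eta>])
      show "(\<eta> has_vector_derivative F (\<eta> t)) (at t within closed_segment 0 \<tau>)"
        if "t \<in> closed_segment 0 \<tau>" for t
        using \<eta>(3)[of t] that sub by (auto intro: has_vector_derivative_within_subset)
    qed (use \<gamma> \<eta> analytic_vfield_on_locally_lipschitz[OF an] in auto)
    then have "snd (\<eta> \<tau>) = 0" using \<gamma>(2) by (metis snd_conv)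
    then have "\<tau> \<notin> open_segment 0 \<tau>'" using \<eta>(4)[of \<tau>] by auto
    then have "\<tau> = \<tau>'" using mem \<tau> by (auto simp: open_segment_def)
    with \<open>\<gamma> \<tau> = \<eta> \<tau>\<close> \<gamma>(2) \<eta>(2) show ?thesis by simp
  qed
  show ?thesis
  proof (cases "\<bar>\<tau>\<bar> \<le> \<bar>\<tau>'\<bar>")
    case True
    then show ?thesis using le[OF orb] assms(4) by simp
  next
    case False
    then show ?thesis using le[OF orb(2,1)] assms(4) by (simp add: mult.commute)
  qed
qed

text \<open>The height s y starts at 0 and is positive afterwards, so its derivative at time 0
  points in the direction of \<tau>. Only the weak inequality survives the limit.\<close>

lemma half_orbit_start_sign:
  assumes "half_orbit s U F \<tau> x x'"
  shows "\<tau> * (s * snd (F (x, 0))) \<ge> 0"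
proof -
  obtain \<gamma> where \<tau>: "\<tau> \<noteq> 0" and \<gamma>: "\<gamma> 0 = (x, 0)" "\<gamma> \<tau> = (x', 0)"
      "\<And>t. t \<in> closed_segment 0 \<tau> \<Longrightarrow>
         (\<gamma> has_vector_derivative F (\<gamma> t)) (at t within closed_segment 0 \<tau>)"
      "\<And>t. t \<in> open_segment 0 \<tau> \<Longrightarrow> s * snd (\<gamma> t) > 0"
    using assms unfolding half_orbit_def by blast
  let ?S = "closed_segment 0 \<tau>"
  let ?h = "\<lambda>t. s * snd (\<gamma> t)"
  have "((\<lambda>t. snd (\<gamma> t)) has_vector_derivative snd (F (\<gamma> 0))) (at 0 within ?S)"
    by (intro bounded_linear.has_vector_derivative[OF bounded_linear_snd] \<gamma>(3)) simp
  then have "(?h has_real_derivative s * snd (F (x, 0))) (at 0 within ?S)"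
    using \<gamma>(1) by (auto simp: has_real_derivative_iff_has_vector_derivative[symmetric]
        intro!: derivative_eq_intros)
  then have "((\<lambda>t. (?h t - ?h 0) / (t - 0)) \<longlongrightarrow> s * snd (F (x, 0))) (at 0 within ?S)"
    by (simp add: has_field_derivative_iff)
  \<comment> \<open>All times of the orbit have the sign of \<tau>, so multiplying by \<tau> treats
    forward and backward orbits together.\<close>
  then have lim: "((\<lambda>t. \<tau> * (?h t / t)) \<longlongrightarrow> \<tau> * (s * snd (F (x, 0)))) (at 0 within ?S)"
    using \<gamma>(1) by (intro tendsto_mult_left) simp
  \<comment> \<open>The limit must be taken along a nontrivial filter to pass on the
    inequality.\<close>
  have "0 islimpt ?S"
    using \<tau> by (intro connected_imp_perfect) (metis connected_segment ends_in_segment singletonD)+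
  then have "at 0 within ?S \<noteq> bot" by (simp add: trivial_limit_within)
  moreover have "\<forall>\<^sub>F t in at 0 within ?S. 0 \<le> \<tau> * (?h t / t)"
    unfolding eventually_at_filter
  proof (intro always_eventually allI impI)
    fix t assume t: "t \<noteq> 0" "t \<in> ?S"
    show "0 \<le> \<tau> * (?h t / t)"
    proof (cases "t = \<tau>")
      case True
      then show ?thesis using \<gamma>(2) by simp
    next
      case False
      with t have "?h t > 0" by (intro \<gamma>(4)) (auto simp: open_segment_def)
      moreover have "\<tau> / t > 0"
        using t \<tau> by (auto simp: closed_segment_eq_real_ivl zero_less_divide_iff split: if_splits)
      ultimately have "?h t * (\<tau> / t) > 0" by (rule mult_pos_pos)
      then show ?thesis by (simp add: mult.commute)
    qed
  qed
  ultimately show ?thesis using tendsto_lowerbound[OF lim] by blast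
qed

lemma half_return_commute: "half_return s U F x x' \<Longrightarrow> half_return s U F x' x"
  unfolding half_return_iff using half_orbit_reverse by blast

text \<open>Where the field crosses the axis, the sign of the vertical component fixes the sign of
  the travel time, and orbit uniqueness applies.\<close>

lemma half_return_unique:
  assumes an: "analytic_vfield_on F U" and s: "s \<noteq> 0" and Y: "snd (F (x, 0)) \<noteq> 0"
    and ret: "half_return s U F x x'" "half_return s U F x x''"
  shows "x' = x''"
proof -
  obtain \<tau> \<tau>' where orb: "half_orbit s U F \<tau> x x'" "half_orbit s U F \<tau>' x x''"
    using ret unfolding half_return_iff by blast
  have pos: "a * b > 0" if "a \<noteq> 0" "b \<noteq> 0" "v \<noteq> 0" "a * v \<ge> 0" "b * v \<ge> 0" for a b v :: real
    using that by (auto simp: zero_le_mult_iff zero_less_mult_iff)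
  have "\<tau> * \<tau>' > 0"
    using orb[THEN half_orbit_start_sign] orb s Y
    by (intro pos[of _ _ "s * snd (F (x, 0))"]) (auto simp: half_orbit_def)
  with half_orbit_unique[OF an orb] show ?thesis .
qed

text \<open>The sign condition is applied at both ends, with times \<tau> and -\<tau>; in the
  product the square (\<tau> s)^2 drops out.\<close>

lemma half_return_opposite_sign:
  assumes s: "s \<noteq> 0" and ret: "half_return s U F x x'"
  shows "snd (F (x, 0)) * snd (F (x', 0)) \<le> 0"
proof -
  obtain \<tau> where orb: "half_orbit s U F \<tau> x x'"
    using ret unfolding half_return_iff by blast
  let ?a = "snd (F (x, 0))" and ?b = "snd (F (x', 0))"
  have "\<tau> \<noteq> 0" using orb by (simp add: half_orbit_def)
  have "0 \<le> (\<tau> * (s * ?a)) * (- \<tau> * (s * ?b))"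
    using half_orbit_start_sign[OF orb] half_orbit_start_sign[OF half_orbit_reverse[OF orb]]
    by (rule mult_nonneg_nonneg)
  also have "\<dots> = (\<tau> * s)\<^sup>2 * - (?a * ?b)" by (simp add: power2_eq_square)
  finally show ?thesis
    using s \<open>\<tau> \<noteq> 0\<close> by (simp add: mult_le_0_iff zero_le_mult_iff)
qed

text \<open>At a tangency the time direction is undetermined, but each direction yields at most one
  return point. Applied at the origin, this will show that \<phi>(x) \<noteq> 0 for small x \<noteq>
  0.\<close>

lemma finite_half_returns:
  assumes "analytic_vfield_on F U"
  shows "finite {x'. half_return s U F x x'}"
proof -
  define P where "P \<sigma> = {x'. \<exists>\<tau>. \<tau> * \<sigma> > 0 \<and> half_orbit s U F \<tau> x x'}" for \<sigma> :: real
  have fin: "finite (P \<sigma>)" for \<sigma>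
  proof -
    have "u = v" if uv: "u \<in> P \<sigma>" "v \<in> P \<sigma>" for u v
    proof -
      obtain \<tau> \<tau>' where *: "\<tau> * \<sigma> > 0" "half_orbit s U F \<tau> x u" "\<tau>' * \<sigma> > 0" "half_orbit s U F \<tau>' x v"
        using uv unfolding P_def by blast
      then have "\<tau> * \<tau>' > 0" by (auto simp: zero_less_mult_iff)
      then show ?thesis using half_orbit_unique[OF assms *(2,4)] by simp
    qed
    then have "P \<sigma> = {} \<or> (\<exists>u. P \<sigma> = {u})" by blast
    then show ?thesis by auto
  qed
  have "{x'. half_return s U F x x'} \<subseteq> P 1 \<union> P (- 1)"
  proof
    fix x' assume "x' \<in> {x'. half_return s U F x x'}"
    then obtain \<tau> where *: "half_orbit s U F \<tau> x x'" by (auto simp: half_return_iff)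
    then have "\<tau> > 0 \<or> \<tau> < 0" by (auto simp: half_orbit_def)
    with * show "x' \<in> P 1 \<union> P (- 1)" unfolding P_def by auto
  qed
  with fin show ?thesis by (meson finite_UnI finite_subset)
qed

section \<open>Power series expansions at the origin\<close>

lemma expansion_at_0_diff:
  assumes "expansion_at_0 \<phi> \<alpha>" "expansion_at_0 \<psi> \<beta>"
  shows "expansion_at_0 (\<lambda>x. \<phi> x - \<psi> x) (\<lambda>n. \<alpha> n - \<beta> n)"
proof -
  obtain r q where "r > 0" "\<And>x. \<bar>x\<bar> < r \<Longrightarrow> (\<lambda>n. \<alpha> n * x ^ n) sums \<phi> x"
    and "q > 0" "\<And>x. \<bar>x\<bar> < q \<Longrightarrow> (\<lambda>n. \<beta> n * x ^ n) sums \<psi> x"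
    using assms unfolding expansion_at_0_def by blast
  then show ?thesis unfolding expansion_at_0_def
    by (intro exI[of _ "min r q"]) (auto simp: left_diff_distrib intro: sums_diff)
qed

lemma expansion_at_0_value:
  assumes "expansion_at_0 \<phi> \<alpha>"
  shows "\<alpha> 0 = \<phi> 0"
proof -
  obtain r where "r > 0" "\<And>x. \<bar>x\<bar> < r \<Longrightarrow> (\<lambda>n. \<alpha> n * x ^ n) sums \<phi> x"
    using assms unfolding expansion_at_0_def by blast
  from this(2)[of 0] this(1) show ?thesis by simp
qed

text \<open>After division by x^n a power series with constant term \<open>\<alpha> n\<close>
  remains. The case n = 0 gives the limit at 0, and n = 1 the slope.\<close>

lemma expansion_at_0_leading_term:
  assumes "expansion_at_0 \<phi> \<alpha>" "\<And>m. m < n \<Longrightarrow> \<alpha> m = 0"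
  shows "((\<lambda>x. \<phi> x / x ^ n) \<longlongrightarrow> \<alpha> n) (at 0)"
proof -
  obtain r where r: "r > 0" "\<And>x. \<bar>x\<bar> < r \<Longrightarrow> (\<lambda>n. \<alpha> n * x ^ n) sums \<phi> x"
    using assms unfolding expansion_at_0_def by blast
  have "((\<lambda>x. \<phi> x / x ^ n) \<longlongrightarrow> \<alpha> (0 + n)) (at 0)"
  proof (rule powser_limit_0_strong[OF r(1)])
    fix x :: real assume x: "x \<noteq> 0" "norm x < r"
    then have "(\<lambda>k. \<alpha> (k + n) * x ^ (k + n)) sums (\<phi> x - (\<Sum>k<n. \<alpha> k * x ^ k))"
      using r(2)[of x] by (intro sums_split_initial_segment) auto
    also have "(\<Sum>k<n. \<alpha> k * x ^ k) = 0" using assms(2) by simp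
    finally have "(\<lambda>k. \<alpha> (k + n) * x ^ (k + n) / x ^ n) sums (\<phi> x / x ^ n)"
      using sums_divide by fastforce
    then show "(\<lambda>k. \<alpha> (k + n) * x ^ k) sums (\<phi> x / x ^ n)"
      using x(1) by (simp add: power_add)
  qed
  then show ?thesis by simp
qed

lemma expansion_at_0_deriv:
  assumes "expansion_at_0 \<phi> \<alpha>"
  shows "\<exists>r>0. \<forall>x. \<bar>x\<bar> < r \<longrightarrow> (\<phi> has_real_derivative deriv \<phi> x) (at x)"
    and "expansion_at_0 (deriv \<phi>) (diffs \<alpha>)"
proof -
  obtain r where r: "r > 0" "\<And>x. \<bar>x\<bar> < r \<Longrightarrow> (\<lambda>n. \<alpha> n * x ^ n) sums \<phi> x"
    using assms unfolding expansion_at_0_def by blast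
  have D: "(\<phi> has_real_derivative deriv \<phi> x) (at x)" if "\<bar>x\<bar> < r" for x
  proof -
    have D: "((\<lambda>z. \<Sum>n. \<alpha> n * z ^ n) has_real_derivative (\<Sum>n. diffs \<alpha> n * x ^ n)) (at x)"
      using r(2) that by (intro termdiffs_strong'[of r]) (auto dest: sums_summable)
    have "\<forall>\<^sub>F z in nhds x. z \<in> {-r<..<r}"
      using that by (intro eventually_nhds_in_open) auto
    then have "\<forall>\<^sub>F z in nhds x. (\<Sum>n. \<alpha> n * z ^ n) = \<phi> z"
      by eventually_elim (auto intro!: sums_unique[symmetric] r(2))
    from iffD1[OF DERIV_cong_ev[OF refl this refl] D]
    have "(\<phi> has_real_derivative (\<Sum>n. diffs \<alpha> n * x ^ n)) (at x)" .
    then show ?thesis by (simp add: DERIV_imp_deriv)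
  qed
  with r(1) show "\<exists>r>0. \<forall>x. \<bar>x\<bar> < r \<longrightarrow> (\<phi> has_real_derivative deriv \<phi> x) (at x)" by blast
  show "expansion_at_0 (deriv \<phi>) (diffs \<alpha>)"
    unfolding expansion_at_0_def
    using r D termdiffs_sums_strong[of r \<alpha> \<phi>] by (intro exI[of _ r]) auto
qed

text \<open>A nonvanishing derivative at 0 excludes the zero series; the first nonzero coefficient
  then governs \<open>g\<close> near 0.\<close>

lemma expansion_at_0_isolated_zeros:
  assumes "expansion_at_0 g a" "(deriv ^^ k) g 0 \<noteq> 0"
  shows "\<forall>\<^sub>F x in at 0. g x \<noteq> 0"
proof -
  obtain r where r: "r > 0" "\<And>x. \<bar>x\<bar> < r \<Longrightarrow> (\<lambda>n. a n * x ^ n) sums g x"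
    using assms unfolding expansion_at_0_def by blast
  have "\<exists>n. a n \<noteq> 0"
  proof (rule ccontr)
    assume "\<not> (\<exists>n. a n \<noteq> 0)"
    \<comment> \<open>The induction needs the whole interval, since a derivative depends on values
      in a neighbourhood.\<close>
    then have "(deriv ^^ k) g x = 0" if "\<bar>x\<bar> < r" for x
      using that
    proof (induction k arbitrary: x)
      case 0
      then have "(\<lambda>n. 0) sums g x" using r(2)[of x] by simp
      from sums_unique2[OF this sums_zero] show ?case by simp
    next
      case (Suc k)
      have "\<forall>\<^sub>F z in nhds x. z \<in> {-r<..<r}"
        using Suc.prems by (intro eventually_nhds_in_open) auto
      then have "\<forall>\<^sub>F z in nhds x. (deriv ^^ k) g z = 0"
        by eventually_elim (use Suc in auto)
      from deriv_cong_ev[OF this refl] show ?case by simp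
    qed
    with r(1) assms(2) show False by simp
  qed
  then obtain n where n: "a n \<noteq> 0" "\<And>m. m < n \<Longrightarrow> a m = 0"
    using exists_least_iff[of "\<lambda>n. a n \<noteq> 0"] by blast
  have "\<forall>\<^sub>F x in at 0. g x / x ^ n \<noteq> 0"
    using tendsto_imp_eventually_ne[OF expansion_at_0_leading_term[OF assms(1) n(2)] n(1)] by simp
  then show ?thesis by eventually_elim auto
qed

text \<open>The error is relative to |u - v|, which differentiability at 0 alone would not give. It
  follows from continuity of the derivative at 0 and the mean value inequality for \<psi>(u) -
  \<beta>_1 u.\<close>

lemma expansion_at_0_strictly_differentiable:
  assumes "expansion_at_0 \<psi> \<beta>" "\<epsilon> > 0"
  shows "\<exists>\<delta>>0. \<forall>u v. \<bar>u\<bar> < \<delta> \<longrightarrow> \<bar>v\<bar> < \<delta> \<longrightarrow> \<bar>\<psi> u - \<psi> v - \<beta> 1 * (u - v)\<bar> \<le> \<epsilon> * \<bar>u - v\<bar>"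
proof -
  note E = expansion_at_0_deriv[OF assms(1)]
  obtain r where r: "r > 0" "\<And>x. \<bar>x\<bar> < r \<Longrightarrow> (\<psi> has_real_derivative deriv \<psi> x) (at x)"
    using E(1) by blast
  have \<beta>1: "deriv \<psi> 0 = \<beta> 1" using expansion_at_0_value[OF E(2)] by (simp add: diffs_def)
  have "(deriv \<psi> \<longlongrightarrow> \<beta> 1) (at 0)"
    using expansion_at_0_leading_term[OF E(2), of 0] by (simp add: diffs_def)
  then obtain d where d: "d > 0" "\<And>x. x \<noteq> 0 \<Longrightarrow> \<bar>x\<bar> < d \<Longrightarrow> \<bar>deriv \<psi> x - \<beta> 1\<bar> < \<epsilon>"
    using tendstoD[OF _ assms(2)] by (force simp: eventually_at dist_real_def)
  define \<delta> where "\<delta> = min r d"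
  have "\<bar>\<psi> u - \<psi> v - \<beta> 1 * (u - v)\<bar> \<le> \<epsilon> * \<bar>u - v\<bar>" if "\<bar>u\<bar> < \<delta>" "\<bar>v\<bar> < \<delta>" for u v
  proof -
    have "norm ((\<psi> u - \<beta> 1 * u) - (\<psi> v - \<beta> 1 * v)) \<le> \<epsilon> * norm (u - v)"
    proof (rule field_differentiable_bound[of "ball 0 \<delta>" _ "\<lambda>x. deriv \<psi> x - \<beta> 1"])
      fix z :: real assume "z \<in> ball 0 \<delta>"
      then have z: "\<bar>z\<bar> < r" "\<bar>z\<bar> < d" by (auto simp: \<delta>_def)
      show "((\<lambda>u. \<psi> u - \<beta> 1 * u) has_field_derivative deriv \<psi> z - \<beta> 1) (at z within ball 0 \<delta>)"
        using has_field_derivative_at_within[OF r(2)[OF z(1)]] by (auto intro!: derivative_eq_intros)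
      show "norm (deriv \<psi> z - \<beta> 1) \<le> \<epsilon>"
        using d(2)[of z] z(2) \<beta>1 assms(2) by (cases "z = 0") auto
    qed (use that in auto)
    then show ?thesis by (simp add: algebra_simps)
  qed
  moreover have "\<delta> > 0" using r d by (simp add: \<delta>_def)
  ultimately show ?thesis by blast
qed

text \<open>Limits at the punctured point 0 can be composed with \<phi> only if \<phi> avoids the
  value 0.\<close>

lemma expansion_at_0_filterlim_at_0:
  assumes "expansion_at_0 \<phi> \<alpha>" "\<phi> 0 = 0" "\<forall>\<^sub>F x in at 0. \<phi> x \<noteq> 0"
  shows "filterlim \<phi> (at 0) (at 0)"
  using expansion_at_0_leading_term[OF assms(1), of 0] expansion_at_0_value[OF assms(1)] assms(2,3)
  by (intro filterlim_atI) auto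

lemma expansion_at_0_slope:
  assumes "expansion_at_0 \<phi> \<alpha>" "\<phi> 0 = 0"
  shows "((\<lambda>x. \<phi> x / x) \<longlongrightarrow> \<alpha> 1) (at 0)"
  using expansion_at_0_leading_term[OF assms(1), of 1] expansion_at_0_value[OF assms(1)] assms(2)
  by simp

text \<open>If \<open>\<phi> - \<psi> \<sim> d x\<^sup>n\<close>, then
  \<open>\<phi> \<circ> \<phi> - \<psi> \<circ> \<psi> = (\<phi> - \<psi>) \<circ> \<phi> + (\<psi> \<circ> \<phi> - \<psi> \<circ> \<psi>) \<sim> ((-1)\<^sup>n - 1) d x\<^sup>n\<close>,
  while the left-hand side vanishes.\<close>

lemma involutions_odd_coefficient:
  assumes \<phi>: "expansion_at_0 \<phi> \<alpha>" "\<phi> 0 = 0" "\<alpha> 1 = -1" "\<forall>\<^sub>F x in at 0. \<phi> (\<phi> x) = x"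
    and \<psi>: "expansion_at_0 \<psi> \<beta>" "\<psi> 0 = 0" "\<beta> 1 = -1" "\<forall>\<^sub>F x in at 0. \<psi> (\<psi> x) = x"
    and eq: "\<And>m. m < n \<Longrightarrow> \<alpha> m = \<beta> m" and "odd n"
  shows "\<alpha> n = \<beta> n"
proof -
  define d where "d = \<alpha> n - \<beta> n"
  define \<Delta> where "\<Delta> x = \<phi> x - \<psi> x" for x
  have \<Delta>: "((\<lambda>x. \<Delta> x / x ^ n) \<longlongrightarrow> d) (at 0)"
    using expansion_at_0_leading_term[OF expansion_at_0_diff[OF \<phi>(1) \<psi>(1)], of n] eq
    by (simp add: \<Delta>_def d_def)
  have nz: "\<forall>\<^sub>F x in at 0. (x :: real) \<noteq> 0"
    by (simp add: eventually_at_filter)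
  \<comment> \<open>If \<phi>(x) = 0, then x = \<phi>(\<phi>(x)) = \<phi>(0) = 0.\<close>
  have "\<forall>\<^sub>F x in at 0. \<phi> x \<noteq> 0"
    using \<phi>(4) nz by eventually_elim (use \<phi>(2) in auto)
  then have \<phi>_lim: "filterlim \<phi> (at 0) (at 0)" and \<phi>_nz: "\<forall>\<^sub>F x in at 0. \<phi> x \<noteq> 0"
    using expansion_at_0_filterlim_at_0[OF \<phi>(1,2)] by auto
  have "\<forall>\<^sub>F x in at 0. \<psi> x \<noteq> 0"
    using \<psi>(4) nz by eventually_elim (use \<psi>(2) in auto)
  then have \<psi>_lim: "filterlim \<psi> (at 0) (at 0)"
    using expansion_at_0_filterlim_at_0[OF \<psi>(1,2)] by auto
  have "((\<lambda>x. \<Delta> (\<phi> x) / \<phi> x ^ n * (\<phi> x / x) ^ n) \<longlongrightarrow> d * (-1) ^ n) (at 0)"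
    using filterlim_compose[OF \<Delta> \<phi>_lim] expansion_at_0_slope[OF \<phi>(1,2)] \<phi>(3)
    by (intro tendsto_intros) auto
  moreover have "\<forall>\<^sub>F x in at 0. \<Delta> (\<phi> x) / \<phi> x ^ n * (\<phi> x / x) ^ n = \<Delta> (\<phi> x) / x ^ n"
    using \<phi>_nz by eventually_elim (simp add: power_divide)
  ultimately have lim1: "((\<lambda>x. \<Delta> (\<phi> x) / x ^ n) \<longlongrightarrow> - d) (at 0)"
    using \<open>odd n\<close> by (auto dest: Lim_transform_eventually)
  \<comment> \<open>Since \<beta>_1 = -1, the numerator is exactly the strict differentiability
    error of \<psi> between \<phi>(x) and \<psi>(x), hence o(\<Delta>(x)).\<close>
  have lim2: "((\<lambda>x. (\<psi> (\<phi> x) - \<psi> (\<psi> x) + \<Delta> x) / x ^ n) \<longlongrightarrow> 0) (at 0)"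
  proof (rule tendstoI)
    fix \<epsilon> :: real assume "\<epsilon> > 0"
    \<comment> \<open>The number |d| + 1 is an eventual bound for |\<Delta>(x) / x^n|, positive even
      if d = 0.\<close>
    then have \<epsilon>: "\<epsilon> / (\<bar>d\<bar> + 1) > 0" by (simp add: add_nonneg_pos)
    obtain \<delta> where \<delta>: "\<delta> > 0" "\<And>u v. \<bar>u\<bar> < \<delta> \<Longrightarrow> \<bar>v\<bar> < \<delta> \<Longrightarrow>
        \<bar>\<psi> u - \<psi> v - \<beta> 1 * (u - v)\<bar> \<le> \<epsilon> / (\<bar>d\<bar> + 1) * \<bar>u - v\<bar>"
      using expansion_at_0_strictly_differentiable[OF \<psi>(1) \<epsilon>] by blast
    have "\<forall>\<^sub>F x in at 0. \<bar>\<phi> x\<bar> < \<delta>" "\<forall>\<^sub>F x in at 0. \<bar>\<psi> x\<bar> < \<delta>"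
      using \<phi>_lim \<psi>_lim \<delta>(1) by (auto simp: filterlim_at dist_real_def dest!: tendstoD)
    moreover have "\<forall>\<^sub>F x in at 0. \<bar>\<Delta> x / x ^ n\<bar> < \<bar>d\<bar> + 1"
      using order_tendstoD(2)[OF tendsto_rabs[OF \<Delta>], of "\<bar>d\<bar> + 1"] by simp
    ultimately show "\<forall>\<^sub>F x in at 0. dist ((\<psi> (\<phi> x) - \<psi> (\<psi> x) + \<Delta> x) / x ^ n) 0 < \<epsilon>"
      using nz
    proof eventually_elim
      case (elim x)
      have "\<bar>\<psi> (\<phi> x) - \<psi> (\<psi> x) + \<Delta> x\<bar> / \<bar>x ^ n\<bar> \<le> \<epsilon> / (\<bar>d\<bar> + 1) * \<bar>\<Delta> x\<bar> / \<bar>x ^ n\<bar>"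
        using \<delta>(2)[OF elim(1,2)] \<psi>(3) by (intro divide_right_mono) (auto simp: \<Delta>_def)
      also have "\<dots> = \<epsilon> / (\<bar>d\<bar> + 1) * \<bar>\<Delta> x / x ^ n\<bar>" by simp
      also have "\<dots> < \<epsilon> / (\<bar>d\<bar> + 1) * (\<bar>d\<bar> + 1)"
        using elim(3) \<epsilon> by (rule mult_strict_left_mono)
      finally show ?case by (simp add: dist_real_def add_nonneg_pos)
    qed
  qed
  have "((\<lambda>x. \<Delta> (\<phi> x) / x ^ n + ((\<psi> (\<phi> x) - \<psi> (\<psi> x) + \<Delta> x) / x ^ n - \<Delta> x / x ^ n))
          \<longlongrightarrow> - d + (0 - d)) (at 0)"
    by (intro tendsto_add tendsto_diff lim1 lim2 \<Delta>)
  \<comment> \<open>The numerators add up to \<phi>(\<phi>(x)) - \<psi>(\<psi>(x)) = x - x. The two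
    limits then force -2d = 0.\<close>
  moreover have "\<forall>\<^sub>F x in at 0.
      \<Delta> (\<phi> x) / x ^ n + ((\<psi> (\<phi> x) - \<psi> (\<psi> x) + \<Delta> x) / x ^ n - \<Delta> x / x ^ n) = 0"
    using \<phi>(4) \<psi>(4)
    by eventually_elim (simp add: \<Delta>_def diff_divide_distrib add_divide_distrib)
  ultimately have "((\<lambda>x. 0) \<longlongrightarrow> - d + (0 - d)) (at (0 :: real))"
    by (rule Lim_transform_eventually)
  then have "0 = - d + (0 - d)" by (rule tendsto_unique[OF _ tendsto_const, rotated]) simp
  then show ?thesis by (simp add: d_def)
qed

section \<open>Half-return maps are involutions\<close>

lemma real_analytic2_on_expansion_axis:
  assumes "real_analytic2_on f U" "(0, 0) \<in> U"
  shows "\<exists>a. expansion_at_0 (\<lambda>x. f (x, 0)) a"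
proof -
  obtain c r where "r > 0" and
    sums: "\<And>x y. \<bar>x\<bar> < r \<Longrightarrow> \<bar>y\<bar> < r \<Longrightarrow>
        ((\<lambda>(i, j). c i j * x ^ i * y ^ j) has_sum f (0 + x, 0 + y)) UNIV"
    using assms unfolding real_analytic2_on_def by fast
  have "(\<lambda>i. c i 0 * x ^ i) sums f (x, 0)" if "\<bar>x\<bar> < r" for x
  proof (rule has_sum_imp_sums)
    have "((\<lambda>(i, j). c i j * x ^ i * 0 ^ j) has_sum f (x, 0)) UNIV"
      using sums[of x 0] that \<open>r > 0\<close> by simp
    \<comment> \<open>The convention 0^0 = 1 keeps exactly the terms with j = 0.\<close>
    also have "?this \<longleftrightarrow> ((\<lambda>(i, j). c i j * x ^ i * 0 ^ j) has_sum f (x, 0)) (range (\<lambda>i. (i, 0)))"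
      by (rule has_sum_cong_neutral) (auto simp: image_iff zero_power)
    also have "\<dots> \<longleftrightarrow> ((\<lambda>i. c i 0 * x ^ i) has_sum f (x, 0)) UNIV"
      by (subst has_sum_reindex) (auto simp: inj_on_def o_def)
    finally show "((\<lambda>i. c i 0 * x ^ i) has_sum f (x, 0)) UNIV" .
  qed
  with \<open>r > 0\<close> show ?thesis unfolding expansion_at_0_def
    by (intro exI[of _ "\<lambda>i. c i 0"] exI[of _ r]) auto
qed

text \<open>The nonzero derivative of order \<open>m - 1\<close> rules out zeros near 0 other than 0
  itself. Continuity prepares an intermediate value argument.\<close>

lemma contact_of_multiplicity_isolated:
  assumes "analytic_vfield_on F U" "(0, 0) \<in> U" "contact_of_multiplicity m F"
  shows "\<exists>e>0. continuous_on {-e<..<e} (\<lambda>x. snd (F (x, 0))) \<and>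
    (\<forall>x. x \<noteq> 0 \<longrightarrow> \<bar>x\<bar> < e \<longrightarrow> snd (F (x, 0)) \<noteq> 0)"
proof -
  let ?g = "\<lambda>x. snd (F (x, 0))"
  obtain a where a: "expansion_at_0 ?g a"
    using real_analytic2_on_expansion_axis[of "\<lambda>p. snd (F p)" U] assms(1,2)
    by (auto simp: analytic_vfield_on_def)
  have "(deriv ^^ (m - 1)) ?g 0 \<noteq> 0"
    using assms(3) by (simp add: contact_of_multiplicity_def partial_x_def)
  from expansion_at_0_isolated_zeros[OF a this]
  obtain d where d: "d > 0" "\<And>x. x \<noteq> 0 \<Longrightarrow> \<bar>x\<bar> < d \<Longrightarrow> ?g x \<noteq> 0"
    by (auto simp: eventually_at dist_real_def)
  obtain r where r: "r > 0" "\<And>x. \<bar>x\<bar> < r \<Longrightarrow> (?g has_real_derivative deriv ?g x) (at x)"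
    using expansion_at_0_deriv(1)[OF a] by blast
  have "continuous_on {- min d r<..<min d r} ?g"
    by (intro continuous_at_imp_continuous_on ballI DERIV_isCont[OF r(2)]) auto
  with d r show ?thesis by (intro exI[of _ "min d r"]) auto
qed

lemma half_return_map_involution:
  assumes an: "analytic_vfield_on F U" "(0, 0) \<in> U" and s: "s \<noteq> 0"
    and contact: "contact_of_multiplicity m F"
    and map: "half_return_map s U F \<phi>" and exp: "expansion_at_0 \<phi> \<alpha>"
  shows "\<forall>\<^sub>F x in at 0. \<phi> (\<phi> x) = x" and "\<alpha> 1 = -1"
proof -
  let ?Y = "\<lambda>x. snd (F (x, 0))"
  have \<phi>0: "\<phi> 0 = 0" using map by (simp add: half_return_map_def)
  obtain e where e: "e > 0" "continuous_on {-e<..<e} ?Y" "\<And>x. x \<noteq> 0 \<Longrightarrow> \<bar>x\<bar> < e \<Longrightarrow> ?Y x \<noteq> 0"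
    using contact_of_multiplicity_isolated[OF an contact] by blast
  have nz: "\<forall>\<^sub>F x in at 0. (x :: real) \<noteq> 0"
    by (simp add: eventually_at_filter)
  have Y: "\<forall>\<^sub>F x in at 0. ?Y x \<noteq> 0"
    unfolding eventually_at using e by (intro exI[of _ e]) (auto simp: dist_real_def)
  have ret: "\<forall>\<^sub>F x in at 0. half_return s U F x (\<phi> x)"
    using map unfolding half_return_map_def eventually_at by (auto simp: dist_real_def)
  \<comment> \<open>The finitely many returns from 0 stay away from a punctured neighbourhood of 0.
    By reversal, no x there can return to 0.\<close>
  have "\<forall>\<^sub>F x in at 0. \<not> half_return s U F 0 x"
    using finite_set_avoid[OF finite_half_returns[OF an(1), of s 0], of 0]
    unfolding eventually_at by (fastforce simp: dist_commute)
  with ret have \<phi>_nz: "\<forall>\<^sub>F x in at 0. \<phi> x \<noteq> 0"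
    by eventually_elim (use half_return_commute in force)
  have \<phi>_lim: "filterlim \<phi> (at 0) (at 0)"
    by (rule expansion_at_0_filterlim_at_0[OF exp \<phi>0 \<phi>_nz])
  note at_\<phi> = eventually_compose_filterlim[OF _ \<phi>_lim]
  \<comment> \<open>Both \<phi>(\<phi>(x)) and, by reversal, x are returns of \<phi>(x), where the
    field crosses the axis.\<close>
  show inv: "\<forall>\<^sub>F x in at 0. \<phi> (\<phi> x) = x"
    using ret at_\<phi>[OF ret] at_\<phi>[OF Y]
  proof eventually_elim
    case (elim x)
    show ?case
      using half_return_unique[OF an(1) s elim(3,2) half_return_commute[OF elim(1)]] .
  qed
  have slope: "((\<lambda>x. \<phi> x / x) \<longlongrightarrow> \<alpha> 1) (at 0)"
    by (rule expansion_at_0_slope[OF exp \<phi>0])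
  have "((\<lambda>x. \<phi> (\<phi> x) / \<phi> x * (\<phi> x / x)) \<longlongrightarrow> \<alpha> 1 * \<alpha> 1) (at 0)"
    by (intro tendsto_mult slope filterlim_compose[OF slope \<phi>_lim])
  moreover have "\<forall>\<^sub>F x in at 0. \<phi> (\<phi> x) / \<phi> x * (\<phi> x / x) = 1"
    using inv nz \<phi>_nz by eventually_elim simp
  ultimately have "((\<lambda>x. 1) \<longlongrightarrow> \<alpha> 1 * \<alpha> 1) (at (0 :: real))"
    by (rule Lim_transform_eventually)
  then have "1 = \<alpha> 1 * \<alpha> 1" by (rule tendsto_unique[OF _ tendsto_const, rotated]) simp
  moreover have "\<not> \<alpha> 1 > 0"
  proof
    assume "\<alpha> 1 > 0"
    then have "\<forall>\<^sub>F x in at 0. \<phi> x / x > 0" by (rule order_tendstoD(1)[OF slope])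
    moreover have "\<forall>\<^sub>F x in at 0. \<bar>\<phi> x\<bar> < e"
      using \<phi>_lim e(1) by (auto simp: filterlim_at dist_real_def dest!: tendstoD)
    ultimately have "\<forall>\<^sub>F x in at 0. \<phi> x / x > 0 \<and> \<bar>\<phi> x\<bar> < e \<and> half_return s U F x (\<phi> x)"
      using ret by eventually_elim auto
    then obtain d where d: "d > 0"
      "\<And>x. x \<noteq> 0 \<Longrightarrow> \<bar>x\<bar> < d \<Longrightarrow> \<phi> x / x > 0 \<and> \<bar>\<phi> x\<bar> < e \<and> half_return s U F x (\<phi> x)"
      by (auto simp: eventually_at dist_real_def)
    \<comment> \<open>A positive point small enough that x and, because of the positive slope,
      \<phi>(x) both lie in the interval (0, e).\<close>
    define x where "x = min d e / 2"
    have x: "0 < x" "x < e" "x < d" using d(1) e(1) by (auto simp: x_def)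
    with d(2)[of x] have \<phi>x: "0 < \<phi> x" "\<phi> x < e" "half_return s U F x (\<phi> x)"
      by (auto simp: zero_less_divide_iff)
    \<comment> \<open>Intermediate value theorem: the image of (0, e) contains values \<le> 0 and
      \<ge> 0, hence 0, although the vertical component has no zero there.\<close>
    have "is_interval (?Y ` {0<..<e})"
      unfolding is_interval_connected_1
      by (intro connected_continuous_image continuous_on_subset[OF e(2)]) auto
    moreover have "?Y x * ?Y (\<phi> x) \<le> 0"
      using half_return_opposite_sign[OF s \<phi>x(3)] .
    then have "?Y x \<le> 0 \<and> 0 \<le> ?Y (\<phi> x) \<or> ?Y (\<phi> x) \<le> 0 \<and> 0 \<le> ?Y x"
      by (auto simp: mult_le_0_iff)
    moreover have "?Y x \<in> ?Y ` {0<..<e}" "?Y (\<phi> x) \<in> ?Y ` {0<..<e}"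
      using x \<phi>x by auto
    ultimately have "0 \<in> ?Y ` {0<..<e}"
      using mem_is_interval_1_I by blast
    then show False using e(3) by force
  qed
  ultimately show "\<alpha> 1 = -1"
    using square_eq_1_iff[of "\<alpha> 1"] by auto
qed

section \<open>Comparison of the two half-return maps\<close>

theorem theoremB:
  fixes Zp Zm :: "real \<times> real \<Rightarrow> real \<times> real"
    and U :: "(real \<times> real) set"
    and kp km l :: nat
    and V :: "nat \<Rightarrow> real"
  assumes "open U" and "(0, 0) \<in> U"
    and "analytic_vfield_on Zp U" and "analytic_vfield_on Zm U"
    and "kp \<ge> 1" and "km \<ge> 1"
    and "monodromic_tangential_singularity kp km Zp Zm"
    and "lyapunov_coefficients U Zp Zm V"
    and "l \<ge> 1"
    and "\<And>n. 2 \<le> n \<Longrightarrow> n \<le> 2 * l \<Longrightarrow> V n = 0"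
  shows "V (2 * l + 1) = 0"
proof -
  obtain \<phi>p \<phi>m \<alpha>p \<alpha>m where
    map: "half_return_map 1 U Zp \<phi>p" "half_return_map (-1) U Zm \<phi>m" and
    exp: "expansion_at_0 \<phi>p \<alpha>p" "expansion_at_0 \<phi>m \<alpha>m" and
    V: "\<And>n. n \<ge> 2 \<Longrightarrow> V n = sgn (fst (Zp (0, 0))) * (\<alpha>p n - \<alpha>m n)"
    using assms(8) unfolding lyapunov_coefficients_def by blast
  have contact: "contact_of_multiplicity (2 * kp) Zp" "contact_of_multiplicity (2 * km) Zm"
    using assms(7) by (auto simp: monodromic_tangential_singularity_def)
  then have "sgn (fst (Zp (0, 0))) \<noteq> 0"
    by (simp add: contact_of_multiplicity_def sgn_zero_iff)
  note invp = half_return_map_involution[OF assms(3,2) _ contact(1) map(1) exp(1), simplified]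
  note invm = half_return_map_involution[OF assms(4,2) _ contact(2) map(2) exp(2), simplified]
  have zero: "\<phi>p 0 = 0" "\<phi>m 0 = 0" using map by (auto simp: half_return_map_def)
  have "\<alpha>p (2 * l + 1) = \<alpha>m (2 * l + 1)"
  proof (rule involutions_odd_coefficient[OF exp(1) zero(1) _ invp(1) exp(2) zero(2) _ invm(1)])
    fix n assume "n < 2 * l + 1"
    \<comment> \<open>The hypothesis on \<open>V\<close> speaks only of indices from 2 on; the
      constant terms are both 0 and the linear coefficients both -1.\<close>
    consider "n = 0" | "n = 1" | "n \<ge> 2" by linarith
    then show "\<alpha>p n = \<alpha>m n"
    proof cases
      case 1
      then show ?thesis using exp[THEN expansion_at_0_value] zero by simp
    next
      case 2
      then show ?thesis using invp(2) invm(2) by simp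
    next
      case 3
      then show ?thesis
        using V[of n] assms(10)[of n] \<open>n < 2 * l + 1\<close> \<open>sgn (fst (Zp (0, 0))) \<noteq> 0\<close> by simp
    qed
  qed (use invp(2) invm(2) in auto)
  then show ?thesis using V[of "2 * l + 1"] assms(9) by simp
qed

end
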